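(* Let $R$ be a commutative ring with identity in which $2$ is invertible, let $r\ge1$, and let $\omega_a$ ($a\ge0$) and $u_1,\dots,u_r$ be parameters in $R$. Then the parameters are admissible if, and only if, they are $u$-admissible.
   Context: For $0\le j\le r$ let $a_j=(-1)^{r-j}\varepsilon_{r-j}(u_1,\dots,u_r)$, where $\varepsilon_k$ is the $k$-th elementary symmetric function (so $a_r=1$ and $\prod_{i=1}^r(t-u_i)=\sum_{j=0}^r a_jt^j$). Write $\delta_{(P)}=1$ if $P$ is true and $\delta_{(P)}=0$ if $P$ is false. The parameters are called admissible if $$\sum_{\mu=0}^{r-j-1}\omega_\mu a_{\mu+j+1}=-2\,\delta_{(r-j\text{ is odd})}\,a_j+\delta_{(j\text{ is even})}\,a_{j+1}\qquad\text{for } 0\le j\le r-1,$$ and $\sum_{\mu=0}^r a_\mu\omega_{\mu+a}=0$ for all $a\ge 0$. The Schur $q$-functions $q_a$ ($a\ge0$) are the symmetric polynomials with integer coefficients in indeterminates $y_1,\dots,y_r$ defined by $\prod_{i=1}^r\frac{1+y_it}{1-y_it}=\sum_{a\ge0}q_a(y_1,\dots,y_r)t^a$. The parameters are called $u$-admissible if $$\omega_a=q_{a+1}(u_1,\dots,u_r)+\tfrac12(-1)^{r-1}q_a(u_1,\dots,u_r)+\tfrac12\delta_{a,0}\qquad\text{for all } a\ge0,$$ where $\delta_{a,0}$ is the Kronecker delta. *)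

theory Defs
  imports "HOL-Computational_Algebra.Computational_Algebra"
begin

text \<open>
  Parameters are families indexed by natural numbers: \<open>u 1, \<dots>, u r\<close>
  (values of \<open>u\<close> at other indices are never used) and \<open>\<omega> 0, \<omega> 1, \<dots>\<close>.
\<close>

definition elem_sym :: "nat \<Rightarrow> (nat \<Rightarrow> 'a::comm_ring_1) \<Rightarrow> nat \<Rightarrow> 'a" where
  "elem_sym r u k = (\<Sum>S | S \<subseteq> {1..r} \<and> card S = k. \<Prod>i\<in>S. u i)"

definition acoef :: "nat \<Rightarrow> (nat \<Rightarrow> 'a::comm_ring_1) \<Rightarrow> nat \<Rightarrow> 'a" where
  "acoef r u j = (- 1) ^ (r - j) * elem_sym r u (r - j)"

definition admissible :: "nat \<Rightarrow> (nat \<Rightarrow> 'a::comm_ring_1) \<Rightarrow> (nat \<Rightarrow> 'a) \<Rightarrow> bool" where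
  "admissible r u \<omega> \<longleftrightarrow>
     (\<forall>j\<in>{0..r - 1}.
        (\<Sum>\<mu>=0..r - j - 1. \<omega> \<mu> * acoef r u (\<mu> + j + 1)) =
          - 2 * of_bool (odd (r - j)) * acoef r u j + of_bool (even j) * acoef r u (j + 1)) \<and>
     (\<forall>a. (\<Sum>\<mu>=0..r. acoef r u \<mu> * \<omega> (\<mu> + a)) = 0)"

text \<open>
  The value \<open>q\<^sub>a(y\<^sub>1, \<dots>, y\<^sub>r)\<close> at ring elements \<open>y\<^sub>i\<close>. Expanding the generating function
  commutes with ring homomorphisms, so this is the evaluation of the integral polynomial \<open>q\<^sub>a\<close>;
  taking the \<open>y\<^sub>i\<close> to be indeterminates gives the polynomial itself. The term
  \<open>fps_right_inverse f 1\<close> is the multiplicative inverse of a series \<open>f\<close> with constant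
  coefficient \<open>1\<close>; \<open>inverse\<close> on series is unavailable over a general commutative ring.
\<close>

definition schur_q_gf :: "nat \<Rightarrow> (nat \<Rightarrow> 'a::comm_ring_1) \<Rightarrow> 'a fps" where
  "schur_q_gf r y =
     (\<Prod>i=1..r. (1 + fps_const (y i) * fps_X) * fps_right_inverse (1 - fps_const (y i) * fps_X) 1)"

definition schur_q :: "nat \<Rightarrow> (nat \<Rightarrow> 'a::comm_ring_1) \<Rightarrow> nat \<Rightarrow> 'a" where
  "schur_q r y a = fps_nth (schur_q_gf r y) a"

text \<open>Only meaningful when \<open>2\<close> is invertible; see \<open>two_mult_half\<close>.\<close>

definition half :: "'a::comm_ring_1" where
  "half = (THE h. 2 * h = 1)"

definition u_admissible :: "nat \<Rightarrow> (nat \<Rightarrow> 'a::comm_ring_1) \<Rightarrow> (nat \<Rightarrow> 'a) \<Rightarrow> bool" where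
  "u_admissible r u \<omega> \<longleftrightarrow>
     (\<forall>a. \<omega> a = schur_q r u (a + 1) + half * (- 1) ^ (r - 1) * schur_q r u a
                  + half * of_bool (a = 0))"

lemma two_mult_half:
  assumes "(2::'a::comm_ring_1) dvd 1"
  shows "2 * (half::'a) = 1"
proof -
  from assms obtain h :: 'a where h: "2 * h = 1"
    unfolding dvd_def by (elim exE) (drule sym)
  have "k = h" if "2 * k = 1" for k
  proof -
    have "k = k * (2 * h)" unfolding h by (rule mult_1_right[symmetric])
    also have "\<dots> = (2 * k) * h" by (simp only: ac_simps)
    also have "\<dots> = h" unfolding that by (rule mult_1_left)
    finally show ?thesis .
  qed
  then show ?thesis
    unfolding half_def by (rule theI[where P = "\<lambda>h. 2 * h = 1", OF h])
qed

lemma schur_q_gf_mult: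
  "(\<Prod>i=1..r. 1 - fps_const (y i) * fps_X) * schur_q_gf r y =
     (\<Prod>i=1..r. 1 + fps_const (y i) * fps_X)"
proof -
  have inv: "(1 - fps_const (y i) * fps_X) * fps_right_inverse (1 - fps_const (y i) * fps_X) 1 = 1"
    for i by (rule fps_right_inverse) simp
  have *: "a * (b * c) = b" if "a * c = 1" for a b c :: "'a fps"
  proof -
    have "a * (b * c) = b * (a * c)" by (rule mult.left_commute)
    then show ?thesis by (simp only: that mult_1_right)
  qed
  show ?thesis
    unfolding schur_q_gf_def prod.distrib[symmetric]
    by (intro prod.cong refl *) (rule inv)
qed

lemma prod_linear_eq_acoef:
  fixes u :: "nat \<Rightarrow> 'a::comm_ring_1"
  shows "(\<Prod>i=1..r. [:- u i, 1:]) = (\<Sum>j\<le>r. monom (acoef r u j) j)"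
proof -
  have c: "(\<Prod>i\<in>S. [:- u i:]) = [:(- 1) ^ card S * (\<Prod>i\<in>S. u i):]" if "finite S" for S
    using that by induction (auto simp: algebra_simps)
  have "(\<Prod>i=1..r. [:- u i, 1:]) = (\<Prod>i=1..r. [:- u i:] + monom 1 1)"
    by (simp add: monom_altdef)
  also have "\<dots> = (\<Sum>S\<in>Pow {1..r}. (\<Prod>i\<in>S. [:- u i:]) * (\<Prod>i\<in>{1..r} - S. monom 1 1))"
    by (rule prod_add) simp
  also have "\<dots> = (\<Sum>S\<in>Pow {1..r}. monom ((- 1) ^ card S * (\<Prod>i\<in>S. u i)) (r - card S))"
  proof (rule sum.cong[OF refl])
    fix S assume "S \<in> Pow {1..r}"
    then have S: "S \<subseteq> {1..r}" "finite S" by (auto intro: finite_subset)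
    then show "(\<Prod>i\<in>S. [:- u i:]) * (\<Prod>i\<in>{1..r} - S. monom 1 1) =
                 monom ((- 1) ^ card S * (\<Prod>i\<in>S. u i)) (r - card S)"
      by (simp add: c card_Diff_subset monom_power smult_monom)
  qed
  also have "\<dots> = (\<Sum>k\<le>r. \<Sum>S\<in>{S\<in>Pow {1..r}. card S = k}.
                     monom ((- 1) ^ card S * (\<Prod>i\<in>S. u i)) (r - card S))"
  proof (rule sum.group[symmetric])
    show "card ` Pow {1..r} \<subseteq> {..r}"
      using card_mono[of "{1..r}"] by fastforce
  qed auto
  also have "\<dots> = (\<Sum>k\<le>r. monom ((- 1) ^ k * elem_sym r u k) (r - k))"
  proof (rule sum.cong[OF refl])
    fix k
    have "(\<Sum>S\<in>{S\<in>Pow {1..r}. card S = k}. monom ((- 1) ^ card S * (\<Prod>i\<in>S. u i)) (r - card S)) =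
          (\<Sum>S\<in>{S\<in>Pow {1..r}. card S = k}. monom ((- 1) ^ k * (\<Prod>i\<in>S. u i)) (r - k))"
      by (rule sum.cong) auto
    also have "\<dots> = monom ((- 1) ^ k * elem_sym r u k) (r - k)"
      by (simp add: elem_sym_def sum_distrib_left monom_sum)
    finally show "(\<Sum>S\<in>{S\<in>Pow {1..r}. card S = k}.
        monom ((- 1) ^ card S * (\<Prod>i\<in>S. u i)) (r - card S)) =
        monom ((- 1) ^ k * elem_sym r u k) (r - k)" .
  qed
  also have "\<dots> = (\<Sum>j\<le>r. monom (acoef r u j) j)"
    by (rule sum.reindex_bij_witness[of _ "\<lambda>j. r - j" "\<lambda>k. r - k"]) (auto simp: acoef_def)
  finally show ?thesis .
qed

end

theory Submission
  imports Defs
begin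

text \<open>
  Put \<open>D(t) = \<Prod>(1 - u\<^sub>i t)\<close>, \<open>E(t) = D(-t)\<close>, \<open>Q(t) = \<Sum>q\<^sub>a t\<^sup>a = E(t) / D(t)\<close> and
  \<open>\<Omega>(t) = \<Sum>\<omega>\<^sub>a t\<^sup>a\<close>. As \<open>a\<^sub>j\<close> is the coefficient of \<open>t\<^bsup>r-j\<^esup>\<close> in \<open>D\<close>, the two families of
  admissibility equations together prescribe all coefficients of \<open>D \<Omega>\<close>: the coefficient of
  \<open>t\<^sup>n\<close> is \<open>-2 \<delta>(n even) d\<^bsub>n+1\<^esub> + \<delta>(n+r odd) d\<^sub>n\<close>. On the other hand, \<open>u\<close>-admissibility says
  \<open>\<Omega> = (Q - 1)/t + (-1)\<^bsup>r-1\<^esup> Q/2 + 1/2\<close>. Multiplying by the unit \<open>D\<close> turns this into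
  \<open>D \<Omega> = (E - D)/t + (-1)\<^bsup>r-1\<^esup> E/2 + D/2\<close>, whose coefficients are exactly the ones above.
\<close>

lemma elem_sym_eq_0: "n > r \<Longrightarrow> elem_sym r u n = 0"
  unfolding elem_sym_def by (rule sum.neutral) (auto dest: card_mono[rotated])

lemma elem_sym_uminus: "elem_sym r (\<lambda>i. - u i) n = (- 1) ^ n * elem_sym r u n"
  unfolding elem_sym_def sum_distrib_left
  by (rule sum.cong) (auto simp: prod_uminus)

lemma elem_sym_0 [simp]: "elem_sym r u 0 = 1"
proof -
  have "{S. S \<subseteq> {1..r} \<and> card S = 0} = {{}}"
    by (auto dest: finite_subset)
  then show ?thesis
    by (simp add: elem_sym_def)
qed

lemma prod_fps_const: "(\<Prod>i\<in>S. fps_const (f i)) = fps_const (\<Prod>i\<in>S. f i)"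
  by (induction S rule: infinite_finite_induct) auto

lemma fps_nth_prod_linear:
  fixes y :: "nat \<Rightarrow> 'a::comm_ring_1"
  shows "fps_nth (\<Prod>i=1..r. 1 + fps_const (y i) * fps_X) n = elem_sym r y n"
proof -
  have "(\<Prod>i=1..r. 1 + fps_const (y i) * fps_X) = (\<Prod>i=1..r. fps_const (y i) * fps_X + 1)"
    by (simp add: add.commute)
  also have "\<dots> = (\<Sum>S\<in>Pow {1..r}. (\<Prod>i\<in>S. fps_const (y i) * fps_X) * (\<Prod>i\<in>{1..r} - S. 1))"
    by (rule prod_add) simp
  also have "\<dots> = (\<Sum>S\<in>Pow {1..r}. fps_const (\<Prod>i\<in>S. y i) * fps_X ^ card S)"
    by (simp add: prod.distrib prod_fps_const)
  finally have "fps_nth (\<Prod>i=1..r. 1 + fps_const (y i) * fps_X) n =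
      (\<Sum>S\<in>Pow {1..r}. if card S = n then \<Prod>i\<in>S. y i else 0)"
    by (auto simp: fps_sum_nth fps_X_power_nth intro!: sum.cong)
  also have "\<dots> = elem_sym r y n"
    unfolding elem_sym_def by (subst sum.inter_filter[symmetric]) (auto intro!: sum.cong)
  finally show ?thesis .
qed

definition denom_fps :: "nat \<Rightarrow> (nat \<Rightarrow> 'a::comm_ring_1) \<Rightarrow> 'a fps" where
  "denom_fps r u = (\<Prod>i=1..r. 1 - fps_const (u i) * fps_X)"

lemma fps_nth_denom: "fps_nth (denom_fps r u) n = (- 1) ^ n * elem_sym r u n"
  using fps_nth_prod_linear[of "\<lambda>i. - u i" r n]
  by (simp add: denom_fps_def elem_sym_uminus flip: fps_const_neg)

lemma fps_nth_denom_0 [simp]: "fps_nth (denom_fps r u) 0 = 1"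
  by (simp add: fps_nth_denom)

lemma acoef_eq_fps_nth: "acoef r u j = fps_nth (denom_fps r u) (r - j)"
  by (simp add: acoef_def fps_nth_denom)

text \<open>Multiplying by the denominator leaves the numerator, which is the denominator with the
  sign of the variable changed.\<close>

lemma denom_times_schur_q_gf:
  "fps_nth (denom_fps r u * schur_q_gf r u) n = (- 1) ^ n * fps_nth (denom_fps r u) n"
  unfolding denom_fps_def schur_q_gf_mult
  unfolding denom_fps_def[symmetric] fps_nth_denom fps_nth_prod_linear
  by (simp flip: mult.assoc power_mult_distrib)

text \<open>The constant coefficient is 1, so the series is a unit over any commutative ring, even
  with zero divisors.\<close>

lemma denom_times_cancel:
  fixes f g :: "'a::comm_ring_1 fps"
  shows "denom_fps r u * f = denom_fps r u * g \<longleftrightarrow> f = g"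
proof
  let ?D = "denom_fps r u" and ?I = "fps_right_inverse (denom_fps r u) 1"
  have "?I * ?D = 1"
    by (subst mult.commute, rule fps_right_inverse) simp
  then have inv: "?I * (?D * h) = h" for h
    by (simp flip: mult.assoc)
  assume "?D * f = ?D * g"
  then have "?I * (?D * f) = ?I * (?D * g)"
    by (rule arg_cong)
  then show "f = g"
    by (simp only: inv)
qed simp

text \<open>The right side of the first family under \<open>n = r - 1 - j\<close>: then
  \<open>r - j = n + 1\<close> is odd iff \<open>n\<close> is even, and \<open>j\<close> is even iff
  \<open>n + r\<close> is odd.\<close>

definition admissible_rhs :: "nat \<Rightarrow> (nat \<Rightarrow> 'a::comm_ring_1) \<Rightarrow> nat \<Rightarrow> 'a" where
  "admissible_rhs r u n = - 2 * of_bool (even n) * fps_nth (denom_fps r u) (n + 1) +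
     of_bool (odd (n + r)) * fps_nth (denom_fps r u) n"

text \<open>The denominator has degree at most \<open>r\<close>. At \<open>n = r\<close> its
  coefficient may survive, but \<open>n + r\<close> is then even.\<close>

lemma admissible_rhs_eq_0: "n \<ge> r \<Longrightarrow> admissible_rhs r u n = 0"
  by (cases "n = r") (simp_all add: admissible_rhs_def fps_nth_denom elem_sym_eq_0)

text \<open>The first family gives the coefficients at \<open>n = r - 1 - j\<close>, that is, below
  \<open>r\<close>; the second gives those at \<open>n = r + a\<close>.\<close>

lemma admissible_iff_fps:
  fixes u \<omega> :: "nat \<Rightarrow> 'a::comm_ring_1"
  assumes "r \<ge> 1"
  shows "admissible r u \<omega> \<longleftrightarrow>
    (\<forall>n. fps_nth (denom_fps r u * Abs_fps \<omega>) n = admissible_rhs r u n)"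
proof -
  let ?D = "denom_fps r u"
  let ?eq = "\<lambda>n. fps_nth (?D * Abs_fps \<omega>) n = admissible_rhs r u n"
  have low: "(\<Sum>\<mu>=0..r - j - 1. \<omega> \<mu> * acoef r u (\<mu> + j + 1)) =
      - 2 * of_bool (odd (r - j)) * acoef r u j + of_bool (even j) * acoef r u (j + 1)
      \<longleftrightarrow> ?eq (r - 1 - j)" if "j \<le> r - 1" for j
  proof -
    have "(\<Sum>\<mu>=0..r - j - 1. \<omega> \<mu> * acoef r u (\<mu> + j + 1)) =
        fps_nth (Abs_fps \<omega> * ?D) (r - 1 - j)"
      unfolding fps_mult_nth acoef_eq_fps_nth
      by (rule sum.cong) (auto intro!: arg_cong[where f = "\<lambda>k. _ * fps_nth ?D k"])
    moreover have "r - 1 - j + 1 = r - j" "r - (j + 1) = r - 1 - j"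
      using that assms by auto
    moreover have "even (r - 1 - j) \<longleftrightarrow> odd (r - j)" "odd (r - 1 - j + r) \<longleftrightarrow> even j"
      using that assms by auto
    ultimately show ?thesis
      unfolding admissible_rhs_def acoef_eq_fps_nth by (simp only: mult.commute[of ?D])
  qed
  have high: "(\<Sum>\<mu>=0..r. acoef r u \<mu> * \<omega> (\<mu> + a)) = 0 \<longleftrightarrow> ?eq (r + a)" for a
  proof -
    \<comment> \<open>The convolution runs up to \<open>r + a\<close>, but its terms with
      \<open>k > r\<close> vanish.\<close>
    have "fps_nth (?D * Abs_fps \<omega>) (r + a) = (\<Sum>k=0..r. fps_nth ?D k * \<omega> (r + a - k))"
      unfolding fps_mult_nth
      by (rule sum.mono_neutral_cong_right) (auto simp: fps_nth_denom elem_sym_eq_0)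
    also have "\<dots> = (\<Sum>\<mu>=0..r. acoef r u \<mu> * \<omega> (\<mu> + a))"
      by (rule sum.reindex_bij_witness[of _ "\<lambda>j. r - j" "\<lambda>k. r - k"])
        (auto simp: acoef_eq_fps_nth)
    finally show ?thesis
      by (simp add: admissible_rhs_eq_0)
  qed
  have "(\<forall>j\<in>{0..r - 1}. ?eq (r - 1 - j)) \<and> (\<forall>a. ?eq (r + a)) \<longleftrightarrow> (\<forall>n. ?eq n)"
  proof (intro iffI allI conjI)
    fix n
    assume *: "(\<forall>j\<in>{0..r - 1}. ?eq (r - 1 - j)) \<and> (\<forall>a. ?eq (r + a))"
    show "?eq n"
    proof (cases "n < r")
      case True
      then have "r - 1 - n \<in> {0..r - 1}" "r - 1 - (r - 1 - n) = n"
        by auto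
      then show ?thesis
        using * by metis
    next
      case False
      then show ?thesis
        using * by (metis le_add_diff_inverse not_less)
    qed
  qed auto
  then show ?thesis
    unfolding admissible_def using low high by simp
qed

lemma u_admissible_iff_fps:
  fixes u \<omega> :: "nat \<Rightarrow> 'a::comm_ring_1"
  assumes two: "(2::'a) dvd 1" and r: "r \<ge> 1"
  shows "u_admissible r u \<omega> \<longleftrightarrow>
    (\<forall>n. fps_nth (denom_fps r u * Abs_fps \<omega>) n = admissible_rhs r u n)"
proof -
  define D where "D = denom_fps r u"
  define Q where "Q = schur_q_gf r u"
  define c :: 'a where "c = half * (- 1) ^ (r - 1)"
  \<comment> \<open>The generating series of the values that u-admissibility prescribes; the
    Kronecker delta becomes the constant series.\<close>
  define T where "T = fps_shift 1 Q + fps_const c * Q + fps_const half"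
  have DQ: "fps_nth (D * Q) n = (- 1) ^ n * fps_nth D n" for n
    by (simp add: D_def Q_def denom_times_schur_q_gf)
  have Q0: "fps_nth Q 0 = 1"
    using DQ[of 0] by (simp add: D_def)
  have "fps_X * fps_shift 1 Q = Q - 1"
    by (rule fps_ext) (auto simp: Q0)
  then have "fps_X * (D * fps_shift 1 Q) = D * Q - D"
    by (simp add: mult.left_commute[of fps_X] right_diff_distrib)
  \<comment> \<open>Reading off the coefficient at \<open>n + 1\<close> cancels the factor
    \<open>fps_X\<close>.\<close>
  then have "fps_nth (fps_X * (D * fps_shift 1 Q)) (n + 1) = fps_nth (D * Q - D) (n + 1)" for n
    by (rule arg_cong)
  then have shift: "fps_nth (D * fps_shift 1 Q) n = ((- 1) ^ (n + 1) - 1) * fps_nth D (n + 1)" for n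
    by (simp only: fps_X_mult_nth fps_sub_nth DQ left_diff_distrib) simp
  have DT: "fps_nth (D * T) n = admissible_rhs r u n" for n
  proof -
    have "D * T = D * fps_shift 1 Q + fps_const c * (D * Q) + fps_const half * D"
      by (simp add: T_def algebra_simps)
    then have "fps_nth (D * T) n = ((- 1) ^ (n + 1) - 1) * fps_nth D (n + 1) +
        half * ((- 1) ^ (r - 1) * (- 1) ^ n + 1) * fps_nth D n"
      by (simp only: fps_add_nth shift fps_mult_left_const_nth DQ c_def) (simp add: algebra_simps)
    moreover have "(- 1) ^ (n + 1) - 1 = (- 2 * of_bool (even n) :: 'a)"
      by auto
    \<comment> \<open>The bracket is 2 if \<open>n + r\<close> is odd and 0 otherwise, since
      \<open>r - 1\<close> and \<open>r\<close> have opposite parity for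
      \<open>r \<ge> 1\<close>.\<close>
    moreover have "half * ((- 1) ^ (r - 1) * (- 1) ^ n + 1) = (of_bool (odd (n + r)) :: 'a)"
      using r two_mult_half[OF two]
      by (cases "even n"; cases "even r") (auto simp: mult.commute[of half])
    ultimately show ?thesis
      by (simp only: admissible_rhs_def D_def)
  qed
  have "u_admissible r u \<omega> \<longleftrightarrow> Abs_fps \<omega> = T"
    by (auto simp: u_admissible_def fps_eq_iff T_def c_def schur_q_def Q_def)
  also have "\<dots> \<longleftrightarrow> D * Abs_fps \<omega> = D * T"
    by (simp add: D_def denom_times_cancel)
  finally show ?thesis
    by (simp only: fps_eq_iff DT) (simp only: D_def)
qed

theorem lemma5p1:
  fixes u \<omega> :: "nat \<Rightarrow> 'a::comm_ring_1" and r :: nat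
  assumes "(2::'a) dvd 1" and "r \<ge> 1"
  shows "admissible r u \<omega> \<longleftrightarrow> u_admissible r u \<omega>"
  using admissible_iff_fps[OF assms(2)] u_admissible_iff_fps[OF assms] by simp

end
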